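(* Let $\mathcal{S}^*=(x_n)_{n\ge1}$ be the sequence in $[0,1)$ defined by $x_1=\frac12$ and, for $N\ge1$, $x_{N+1}:=\min\operatorname*{arg\,min}_{x\in[0,1)}f_N(x)$ (the smallest global minimizer of $f_N$ on $[0,1)$), where $$f_N(x):=-2\sum_{n=1}^N\max\{x_n,x\}+(N+1)x^2-x.$$ Then for all $N\in\mathbb{N}$ we have $x_N\in\Gamma_N:=\left\{\frac{2n-1}{2N}:n=1,2,\dots,N\right\}$. Further, $x_N$ is different from all previous elements $x_1,\dots,x_{N-1}$ of $\mathcal{S}^*$.
   Context: $\operatorname*{arg\,min}_{x\in M}f(x)$ denotes the set $\{x\in M: f(x)\le f(y)\text{ for all }y\in M\}$. $\mathbb{N}=\{1,2,3,\dots\}$. *)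

theory Defs
  imports "HOL-Analysis.Analysis"
begin

definition argmin_set :: "('a \<Rightarrow> real) \<Rightarrow> 'a set \<Rightarrow> 'a set" where
  "argmin_set f M = {x \<in> M. \<forall>y \<in> M. f x \<le> f y}"

definition f_obj :: "(nat \<Rightarrow> real) \<Rightarrow> nat \<Rightarrow> real \<Rightarrow> real" where
  "f_obj x N y = - 2 * (\<Sum>n = 1..N. max (x n) y) + (real N + 1) * y\<^sup>2 - y"

lemma f_obj_cong [fundef_cong]:
  "N = N' \<Longrightarrow> (\<And>n. 1 \<le> n \<Longrightarrow> n \<le> N' \<Longrightarrow> x n = x' n) \<Longrightarrow> f_obj x N = f_obj x' N'"
  by (auto simp: f_obj_def fun_eq_iff intro!: sum.cong)

text \<open>The sequence is indexed from 1; the value at index 0 is a dummy. \<^const>\<open>Least\<close> is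
  unspecified if there is no least element; the lemma \<open>S_star_is_least\<close> below shows that
  this does not happen.\<close>

fun S_star :: "nat \<Rightarrow> real" where
  "S_star 0 = 0"
| "S_star (Suc 0) = 1 / 2"
| "S_star (Suc (Suc k)) = (LEAST y. y \<in> argmin_set (f_obj S_star (Suc k)) {0..<1})"

definition Gamma_set :: "nat \<Rightarrow> real set" where
  "Gamma_set N = {(2 * real n - 1) / (2 * real N) |n. 1 \<le> n \<and> n \<le> N}"

lemma f_obj_less_at_1:
  assumes "\<And>n. 1 \<le> n \<Longrightarrow> n \<le> N \<Longrightarrow> x n < 1"
  shows "\<exists>y \<in> {0..<1}. f_obj x N y < f_obj x N 1"
proof -
  let ?A = "insert ((real N + 1/2) / (real N + 1)) (x ` {1..N})"
  define y where "y = Max ?A"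
  have y_ge: "z \<le> y" if "z \<in> ?A" for z
    unfolding y_def using that by (intro Max_ge) auto
  have "y \<in> ?A"
    unfolding y_def by (intro Max_in) auto
  then have y1: "y < 1"
  proof (rule insertE)
    assume "y = (real N + 1/2) / (real N + 1)"
    then show ?thesis by simp
  next
    assume "y \<in> x ` {1..N}"
    then show ?thesis using assms by auto
  qed
  have yN: "(real N + 1/2) / (real N + 1) \<le> y"
    by (rule y_ge) simp
  then have y0: "0 \<le> y"
    by (rule order_trans[rotated]) simp
  have "real N + 1/2 \<le> (real N + 1) * y"
    using yN by (simp add: field_simps)
  then have "(1 - y) * (real N - (real N + 1) * y) < 0"
    using y1 by (intro mult_pos_neg) auto
  moreover have "(\<Sum>n = 1..N. max (x n) y) = real N * y"
    using y_ge by (subst sum.cong[OF refl, of _ _ "\<lambda>_. y"]) (auto simp: max_def intro: antisym)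
  moreover have "(\<Sum>n = 1..N. max (x n) 1) = real N"
    using assms by (subst sum.cong[OF refl, of _ _ "\<lambda>_. 1"]) (auto simp: max_def dest: less_imp_le)
  ultimately have "f_obj x N y < f_obj x N 1"
    unfolding f_obj_def by (simp add: algebra_simps power2_eq_square)
  then show ?thesis using y0 y1 by auto
qed

lemma argmin_f_obj_has_least:
  assumes "\<And>n. 1 \<le> n \<Longrightarrow> n \<le> N \<Longrightarrow> x n < 1"
  shows "\<exists>m \<in> argmin_set (f_obj x N) {0..<1}. \<forall>p \<in> argmin_set (f_obj x N) {0..<1}. m \<le> p"
proof -
  let ?f = "f_obj x N"
  have cont: "continuous_on {0..1} ?f"
    unfolding f_obj_def by (intro continuous_intros)
  obtain a where a: "a \<in> {0..1}" "\<And>z. z \<in> {0..1} \<Longrightarrow> ?f a \<le> ?f z"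
    using continuous_attains_inf[OF _ _ cont] by auto
  define A where "A = {y \<in> {0..1}. ?f y \<in> {..?f a}}"
  have "closed A"
    unfolding A_def using continuous_closed_preimage[OF cont, of "{..?f a}"]
    by (simp add: vimage_def Int_def)
  moreover have "bounded A"
    by (rule bounded_subset[of "{0..1}"]) (auto simp: A_def)
  ultimately have "compact A" by (simp add: compact_eq_bounded_closed)
  moreover have "A \<noteq> {}" using a(1) by (auto simp: A_def)
  ultimately obtain m where m: "m \<in> A" "\<And>p. p \<in> A \<Longrightarrow> m \<le> p"
    using compact_attains_inf[of A] by blast
  have m_min: "?f m \<le> ?f z" if "z \<in> {0..1}" for z
    using m(1) a(2)[OF that] by (auto simp: A_def)
  obtain y where y: "y \<in> {0..<1}" "?f y < ?f 1"
    using f_obj_less_at_1[of N x] assms by blast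
  have "m \<noteq> 1" using m_min[of y] y by auto
  then have mem: "m \<in> {0..<1}" using m(1) by (auto simp: A_def)
  show ?thesis
  proof (intro bexI[of _ m] ballI)
    show "m \<in> argmin_set ?f {0..<1}"
      using mem m_min by (auto simp: argmin_set_def)
  next
    fix p assume "p \<in> argmin_set ?f {0..<1}"
    then have "p \<in> {0..1}" "?f p \<le> ?f m" using mem by (auto simp: argmin_set_def)
    then have "p \<in> A" using m(1) by (auto simp: A_def)
    then show "m \<le> p" by (rule m(2))
  qed
qed

lemma Least_argmin_f_obj:
  assumes "\<And>n. 1 \<le> n \<Longrightarrow> n \<le> N \<Longrightarrow> x n < 1"
  defines "m \<equiv> LEAST y. y \<in> argmin_set (f_obj x N) {0..<1}"
  shows "m \<in> argmin_set (f_obj x N) {0..<1}"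
    and "p \<in> argmin_set (f_obj x N) {0..<1} \<Longrightarrow> m \<le> p"
proof -
  obtain q where q: "q \<in> argmin_set (f_obj x N) {0..<1}"
      "\<And>p. p \<in> argmin_set (f_obj x N) {0..<1} \<Longrightarrow> q \<le> p"
    using argmin_f_obj_has_least[of N x] assms(1) by blast
  then have "m = q" unfolding m_def by (intro Least_equality) auto
  with q show "m \<in> argmin_set (f_obj x N) {0..<1}"
    and "p \<in> argmin_set (f_obj x N) {0..<1} \<Longrightarrow> m \<le> p" by auto
qed

lemma S_star_in_unit: "S_star N \<in> {0..<1}"
proof (induction N rule: less_induct)
  case (less N)
  consider "N = 0" | "N = Suc 0" | k where "N = Suc (Suc k)"
    by (metis not0_implies_Suc)
  then show ?case
  proof cases
    case 3
    have "S_star n < 1" if "1 \<le> n" "n \<le> Suc k" for n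
      using less.IH[of n] that 3 by auto
    from Least_argmin_f_obj(1)[of "Suc k" S_star, OF this] show ?thesis
      by (simp add: 3 argmin_set_def)
  qed auto
qed

lemma S_star_is_least:
  assumes "N \<ge> 1"
  shows "S_star (N + 1) \<in> argmin_set (f_obj S_star N) {0..<1}"
    and "p \<in> argmin_set (f_obj S_star N) {0..<1} \<Longrightarrow> S_star (N + 1) \<le> p"
proof -
  obtain k where k: "N = Suc k" using assms by (cases N) auto
  have lt: "\<And>n. S_star n < 1" using S_star_in_unit by auto
  show "S_star (N + 1) \<in> argmin_set (f_obj S_star N) {0..<1}"
    and "p \<in> argmin_set (f_obj S_star N) {0..<1} \<Longrightarrow> S_star (N + 1) \<le> p"
    using Least_argmin_f_obj[of N S_star] lt by (simp_all add: k)
qed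

end

(* A set A of indices with {x n < y} \<subseteq> A \<subseteq> {x n \<le> y} gives a quadratic in h that lies above
   f_N (y + h) for every h and touches it at h = 0. At a minimizer y of f_N on [0,1), which cannot
   be 0, the derivative of this quadratic at h = 0 must vanish: 2 (N + 1) y = 2 card A + 1. Any
   admissible A puts y into Gamma_(N+1), and since all admissible A have the same cardinality, the
   two extreme ones agree, so y is none of the x n. *)
theory Submission imports Defs begin

text \<open>Each \<open>max (x n) (y + h)\<close> is bounded below by one of its two arguments:
  \<open>y + h\<close> for \<open>n\<close> in \<open>A\<close>, \<open>x n\<close> otherwise. The
  factor -2 in \<open>f_obj\<close> turns this into an upper bound.\<close>

lemma f_obj_quadratic_majorant:
  assumes "A \<subseteq> {1..N}"
    and "\<And>n. n \<in> A \<Longrightarrow> x n \<le> y"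
    and "\<And>n. n \<in> {1..N} - A \<Longrightarrow> y \<le> x n"
  shows "f_obj x N (y + h) \<le>
    f_obj x N y + h * (2 * (real N + 1) * y - 2 * real (card A) - 1) + (real N + 1) * h\<^sup>2"
proof -
  have "max (x n) y + (if n \<in> A then h else 0) \<le> max (x n) (y + h)" if "n \<in> {1..N}" for n
    using assms(2)[of n] assms(3)[of n] that by (cases "n \<in> A") auto
  then have "(\<Sum>n = 1..N. max (x n) y + (if n \<in> A then h else 0)) \<le> (\<Sum>n = 1..N. max (x n) (y + h))"
    by (rule sum_mono)
  moreover have "(\<Sum>n = 1..N. if n \<in> A then h else 0) = real (card A) * h"
    using assms(1) by (simp add: sum.If_cases Int_absorb1)
  ultimately show ?thesis
    by (simp add: f_obj_def sum.distrib power2_eq_square algebra_simps)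
qed

lemma argmin_f_obj_pos:
  assumes "y \<in> argmin_set (f_obj x N) {0..<1}"
  shows "0 < y"
proof (rule ccontr)
  assume "\<not> 0 < y"
  with assms have y: "y = 0" by (auto simp: argmin_set_def)
  \<comment> \<open>This \<open>h\<close> minimizes \<open>- h + (real N + 1) * h\<^sup>2\<close>.
    The slope of the majorant at 0 is at most -1, so moving to \<open>h\<close> lowers
    \<open>f_obj\<close> by at least \<open>h / 2\<close>.\<close>
  define h where "h = 1 / (2 * (real N + 1))"
  let ?A = "{n \<in> {1..N}. x n \<le> 0}"
  have h: "0 < h" "h < 1" "(real N + 1) * h = 1 / 2"
    by (simp_all add: h_def field_simps)
  then have "f_obj x N 0 \<le> f_obj x N h"
    using assms y by (auto simp: argmin_set_def)
  also have "\<dots> \<le> f_obj x N 0 + h * (- 2 * real (card ?A) - 1) + (real N + 1) * h\<^sup>2"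
    using f_obj_quadratic_majorant[of ?A N x 0 h] by fastforce
  also have "(real N + 1) * h\<^sup>2 = h / 2"
    using arg_cong[OF h(3), of "\<lambda>t. t * h"] by (simp only: power2_eq_square mult.assoc)
  finally have "h / 2 + 2 * (h * real (card ?A)) \<le> 0"
    by (simp add: right_diff_distrib)
  moreover have "0 \<le> h * real (card ?A)"
    using h(1) by simp
  ultimately show False using h(1) by linarith
qed

text \<open>\<open>f_obj\<close> may have a concave kink at a point \<open>x n\<close>, so the
  derivative test is applied to the smooth majorant, which inherits the local minimum.
  \<open>A\<close> stays free so that different choices can be compared.\<close>

lemma argmin_f_obj_critical:
  assumes y: "y \<in> argmin_set (f_obj x N) {0..<1}"
    and A: "A \<subseteq> {1..N}" "\<And>n. n \<in> A \<Longrightarrow> x n \<le> y" "\<And>n. n \<in> {1..N} - A \<Longrightarrow> y \<le> x n"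
  shows "2 * (real N + 1) * y = 2 * real (card A) + 1"
proof -
  define c where "c = 2 * (real N + 1) * y - 2 * real (card A) - 1"
  let ?g = "\<lambda>h. f_obj x N y + h * c + (real N + 1) * h\<^sup>2"
  have "(?g has_real_derivative c) (at 0)"
    by (auto intro!: derivative_eq_intros)
  \<comment> \<open>With this radius \<open>y + h\<close> stays in \<open>{0..<1}\<close>, where
    \<open>y\<close> is known to be minimal.\<close>
  moreover have "0 < min y (1 - y)"
    using argmin_f_obj_pos[OF y] y by (auto simp: argmin_set_def)
  moreover have "?g 0 \<le> ?g h" if "\<bar>0 - h\<bar> < min y (1 - y)" for h
  proof -
    have "y + h \<in> {0..<1}"
      using that by auto
    then have "f_obj x N y \<le> f_obj x N (y + h)"
      using y by (auto simp: argmin_set_def)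
    also have "\<dots> \<le> ?g h"
      unfolding c_def by (rule f_obj_quadratic_majorant[OF A])
    finally show ?thesis by simp
  qed
  ultimately have "c = 0"
    by (intro DERIV_local_min[of ?g c 0 "min y (1 - y)"]) auto
  then show ?thesis by (simp add: c_def)
qed

lemma argmin_f_obj_in_Gamma_set:
  assumes "y \<in> argmin_set (f_obj x N) {0..<1}"
  shows "y \<in> Gamma_set (N + 1)"
proof -
  let ?A = "{n \<in> {1..N}. x n \<le> y}"
  have "2 * (real N + 1) * y = 2 * real (card ?A) + 1"
    by (rule argmin_f_obj_critical[OF assms]) auto
  \<comment> \<open>The index in \<open>Gamma_set (N + 1)\<close> is
    \<open>card ?A + 1\<close>.\<close>
  then have "y = (2 * real (card ?A + 1) - 1) / (2 * real (N + 1))"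
    by (simp add: field_simps)
  moreover have "card ?A \<le> N"
    using card_mono[of "{1..N}" ?A] by fastforce
  ultimately show ?thesis
    unfolding Gamma_set_def by (intro CollectI exI[of _ "card ?A + 1"]) simp
qed

lemma argmin_f_obj_neq:
  assumes "y \<in> argmin_set (f_obj x N) {0..<1}" and "m \<in> {1..N}"
  shows "y \<noteq> x m"
proof
  assume "y = x m"
  let ?A = "{n \<in> {1..N}. x n < y}" and ?B = "{n \<in> {1..N}. x n \<le> y}"
  have "2 * (real N + 1) * y = 2 * real (card ?A) + 1"
    by (rule argmin_f_obj_critical[OF assms(1)]) auto
  moreover have "2 * (real N + 1) * y = 2 * real (card ?B) + 1"
    by (rule argmin_f_obj_critical[OF assms(1)]) auto
  \<comment> \<open>The index \<open>m\<close> lies in \<open>?B\<close> but not in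
    \<open>?A\<close>.\<close>
  moreover have "card ?A < card ?B"
    using assms(2) \<open>y = x m\<close> by (intro psubset_card_mono) auto
  ultimately show False by simp
qed

theorem theorem2:
  fixes N :: nat
  assumes "N \<ge> 1"
  shows "S_star N \<in> Gamma_set N \<and> (\<forall>m. 1 \<le> m \<and> m < N \<longrightarrow> S_star N \<noteq> S_star m)"
proof (cases "N = 1")
  case True
  then show ?thesis by (auto simp: Gamma_set_def)
next
  case False
  \<comment> \<open>For \<open>N > 1\<close>, \<open>S_star N\<close> minimizes the objective built
    from the \<open>k = N - 1\<close> earlier terms.\<close>
  with assms obtain k where k: "N = k + 1" "k \<ge> 1"
    by (cases N) auto
  have min: "S_star N \<in> argmin_set (f_obj S_star k) {0..<1}"
    using S_star_is_least(1)[OF k(2)] k(1) by simp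
  show ?thesis
    using argmin_f_obj_in_Gamma_set[OF min] argmin_f_obj_neq[OF min] k(1) by auto
qed

end
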